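(* Let $m,n\in\mathbb{N}$, $\nu_j\in(0,1]$ and $\lambda_j>0$ for $j=1,\dots,m$, $\beta\in(0,1]$ and $c>0$. The solution to the problem $$\begin{cases}\displaystyle\sum_{j=1}^m\lambda_j\dfrac{{}^C\partial^{\nu_j}}{\partial t^{\nu_j}}w(\mathbf{x},t)=-c^2(-\Delta)^\beta w(\mathbf{x},t), & \mathbf{x}\in\mathbb{R}^n,\ t>0,\\ w(\mathbf{x},0)=\delta(\mathbf{x}),\end{cases}$$ where ${}^C\partial^{\nu}/\partial t^{\nu}$ is the Dzerbayshan-Caputo fractional derivative, is given by the law (probability density) of the process $$\mathbf{W}_n(t)=\mathbf{S}_n^{2\beta}\bigl(c^2\mathcal{L}^{\nu_1,\dots,\nu_m}(t)\bigr),\qquad t>0,$$ where $\mathbf{S}_n^{2\beta}$ is the isotropic $n$-dimensional stable process with $\mathbb{E}e^{i\boldsymbol{\xi}\cdot\mathbf{S}_n^{2\beta}(t)}=e^{-t\|\boldsymbol{\xi}\|^{2\beta}}$, independent of the process $$\mathcal{L}^{\nu_1,\dots,\nu_m}(t)=\inf\Bigl\{s>0:\sum_{j=1}^m\lambda_j^{1/\nu_j}H_j^{\nu_j}(s)\ge t\Bigr\},\qquad t>0,$$ and the $H_j^{\nu_j}$ are independent stable subordinators of order $\nu_j$.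
   Context: A stable subordinator $H^\nu(t)$, $t>0$, of order $\nu\in(0,1]$ is the nonnegative process with stationary independent increments, started at $0$, with $\mathbb{E}e^{-\mu H^\nu(t)}=e^{-t\mu^\nu}$ for $\mu>0$ (so $H^1(t)=t$). For $\nu\in(0,1)$ the Dzerbayshan-Caputo derivative is $\frac{{}^C\partial^\nu}{\partial t^\nu}f(t)=\frac{1}{\Gamma(1-\nu)}\int_0^t\frac{f'(s)}{(t-s)^{\nu}}\,ds$; for $\nu=1$ it is the ordinary derivative. Its Laplace transform is $\mu^\nu\widetilde f(\mu)-\mu^{\nu-1}f(0)$. The fractional Laplacian is defined by Fourier transform: $-(-\Delta)^\beta$ is the operator with Fourier multiplier $-\|\boldsymbol{\xi}\|^{2\beta}$, where $\|\cdot\|$ is the Euclidean norm and $\widehat u(\boldsymbol{\xi})=\int_{\mathbb{R}^n}e^{i\boldsymbol{\xi}\cdot\mathbf{x}}u(\mathbf{x})\,d\mathbf{x}$. "Solution" is understood at the level of transforms, as is done throughout the paper: the Fourier transform in $\mathbf{x}$ and Laplace transform in $t$ of $w$, denoted $\widehat{\widetilde w}(\boldsymbol{\xi},\mu)$, satisfy the equation obtained by transforming the problem with the Laplace rule $\frac{{}^C\partial^\nu}{\partial t^\nu}f\mapsto\mu^\nu\widetilde f(\mu)-\mu^{\nu-1}f(0)$ and the Fourier multiplier $-\|\boldsymbol{\xi}\|^{2\beta}$ of $-(-\Delta)^\beta$, that is, $\sum_{j=1}^m\lambda_j\bigl(\mu^{\nu_j}\widehat{\widetilde w}(\boldsymbol{\xi},\mu)-\mu^{\nu_j-1}\bigr)=-c^2\|\boldsymbol{\xi}\|^{2\beta}\widehat{\widetilde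 w}(\boldsymbol{\xi},\mu)$ for $\boldsymbol{\xi}\in\mathbb{R}^n$, $\mu>0$, and $\widehat w(\boldsymbol{\xi},0)=1$. Here $\delta$ is the Dirac delta. *)

theory Defs
  imports "HOL-Probability.Probability"
begin

definition cadlag :: "(real \<Rightarrow> 'b::topological_space) \<Rightarrow> bool" where
  "cadlag f \<longleftrightarrow> (\<forall>t\<ge>0. continuous (at_right t) f) \<and> (\<forall>t>0. \<exists>l. (f \<longlongrightarrow> l) (at_left t))"

text \<open>Processes are indexed by real time, of which only the part \<open>t \<ge> 0\<close> is constrained.\<close>

definition levy_process :: "'a measure \<Rightarrow> (real \<Rightarrow> 'a \<Rightarrow> 'b::euclidean_space) \<Rightarrow> bool" where
  "levy_process M X \<longleftrightarrow>
     (\<forall>t\<ge>0. X t \<in> borel_measurable M) \<and>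
     (AE \<omega> in M. X 0 \<omega> = 0) \<and>
     (\<forall>s\<ge>0. \<forall>h\<ge>0. distr M borel (\<lambda>\<omega>. X (s + h) \<omega> - X s \<omega>)
                     = distr M borel (\<lambda>\<omega>. X h \<omega> - X 0 \<omega>)) \<and>
     (\<forall>(k::nat) (t::nat \<Rightarrow> real). 0 \<le> t 0 \<longrightarrow> (\<forall>i<k. t i \<le> t (Suc i)) \<longrightarrow>
        prob_space.indep_vars M (\<lambda>_. borel) (\<lambda>i \<omega>. X (t (Suc i)) \<omega> - X (t i) \<omega>) {..<k}) \<and>
     (AE \<omega> in M. cadlag (\<lambda>t. X t \<omega>))"

definition stable_subordinator :: "'a measure \<Rightarrow> real \<Rightarrow> (real \<Rightarrow> 'a \<Rightarrow> real) \<Rightarrow> bool" where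
  "stable_subordinator M \<nu> H \<longleftrightarrow>
     levy_process M H \<and>
     (AE \<omega> in M. \<forall>t\<ge>0. 0 \<le> H t \<omega>) \<and>
     (\<forall>t\<ge>0. \<forall>\<mu>>0. (LINT \<omega>|M. exp (- \<mu> * H t \<omega>)) = exp (- t * \<mu> powr \<nu>))"

definition isotropic_stable_process ::
    "'a measure \<Rightarrow> real \<Rightarrow> (real \<Rightarrow> 'a \<Rightarrow> real ^ 'n) \<Rightarrow> bool" where
  "isotropic_stable_process M \<beta> S \<longleftrightarrow>
     levy_process M S \<and>
     (\<forall>t\<ge>0. \<forall>\<xi>. (LINT \<omega>|M. iexp (\<xi> \<bullet> S t \<omega>))
                 = complex_of_real (exp (- t * norm \<xi> powr (2 * \<beta>))))"

text \<open>The path of a process on the time set \<open>T\<close>, as a random element of the product space; it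
  serves to express independence of whole processes.\<close>

definition path_on :: "real set \<Rightarrow> (real \<Rightarrow> 'a \<Rightarrow> 'b) \<Rightarrow> 'a \<Rightarrow> real \<Rightarrow> 'b" where
  "path_on T X \<omega> = (\<lambda>t\<in>T. X t \<omega>)"

abbreviation path_space :: "real set \<Rightarrow> (real \<Rightarrow> 'b::topological_space) measure" where
  "path_space T \<equiv> Pi\<^sub>M T (\<lambda>_. borel)"

text \<open>\<open>indep_var\<close> requires both random elements to have the same type; this is its
  analogue for two different types.\<close>

definition indep_elements ::
    "'a measure \<Rightarrow> 'b measure \<Rightarrow> ('a \<Rightarrow> 'b) \<Rightarrow> 'c measure \<Rightarrow> ('a \<Rightarrow> 'c) \<Rightarrow> bool" where
  "indep_elements M N X K Y \<longleftrightarrow>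
     X \<in> measurable M N \<and> Y \<in> measurable M K \<and>
     prob_space.indep_set M {X -` A \<inter> space M | A. A \<in> sets N} {Y -` B \<inter> space M | B. B \<in> sets K}"

text \<open>For \<open>t > 0\<close> the set below is nonempty almost surely. At \<open>t = 0\<close> the same formula gives
  \<open>0\<close> almost surely, which extends the process to \<open>t \<ge> 0\<close>.\<close>

definition inverse_process ::
    "nat \<Rightarrow> (nat \<Rightarrow> real) \<Rightarrow> (nat \<Rightarrow> real) \<Rightarrow> (nat \<Rightarrow> real \<Rightarrow> 'a \<Rightarrow> real) \<Rightarrow> real \<Rightarrow> 'a \<Rightarrow> real" where
  "inverse_process m \<nu> lam H t \<omega> =
     Inf {s. 0 < s \<and> t \<le> (\<Sum>j=1..m. lam j powr (1 / \<nu> j) * H j s \<omega>)}"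

text \<open>The paths are regular only almost surely, so first passage times and time-changed processes
  need be measurable only for the completed probability measure. If \<open>X\<close> is measurable for \<open>M\<close>
  itself, this is \<open>distr M borel X\<close>.\<close>

definition law :: "'a measure \<Rightarrow> ('a \<Rightarrow> 'b::topological_space) \<Rightarrow> 'b measure" where
  "law M X = distr (completion M) borel X"

text \<open>The Fourier transform of a measure; for a measure with Lebesgue density \<open>u\<close> it is
  \<open>\<integral> e\<^sup>i\<^sup>\<xi>\<^sup>\<cdot>\<^sup>x u(x) dx\<close>, and it is identically \<open>1\<close> exactly for the Dirac measure at \<open>0\<close>.\<close>

definition fourier :: "(real ^ 'n) measure \<Rightarrow> real ^ 'n \<Rightarrow> complex" where
  "fourier N \<xi> = (LINT x|N. iexp (\<xi> \<bullet> x))"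

definition laplace_exists :: "(real \<Rightarrow> complex) \<Rightarrow> real \<Rightarrow> bool" where
  "laplace_exists f \<mu> \<longleftrightarrow> set_integrable lborel {0<..} (\<lambda>t. exp (- \<mu> * t) *\<^sub>R f t)"

definition laplace :: "(real \<Rightarrow> complex) \<Rightarrow> real \<Rightarrow> complex" where
  "laplace f \<mu> = (LINT t:{0<..}|lborel. exp (- \<mu> * t) *\<^sub>R f t)"

text \<open>Solutions, at the level of transforms, of
    \<open>\<Sum>j. \<lambda>\<^sub>j \<partial>\<^sub>t\<^sup>\<nu>\<^sup>j w = - c\<^sup>2 (-\<Delta>)\<^sup>\<beta> w\<close>, \<open>w(\<cdot>,0) = \<delta>\<close>,
  with Caputo derivatives and the fractional Laplacian. The unknown \<open>w t\<close> is a measure, as the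
  initial datum is. The Caputo derivative of order \<open>\<nu>\<close> of \<open>f\<close> has Laplace transform
  \<open>\<mu>\<^sup>\<nu> laplace f \<mu> - \<mu>\<^sup>\<nu>\<^sup>-\<^sup>1 f(0)\<close>, and \<open>-(-\<Delta>)\<^sup>\<beta>\<close> has Fourier multiplier \<open>-\<parallel>\<xi>\<parallel>\<^sup>2\<^sup>\<beta>\<close>. The continuity
  clause ties the initial value to the values at \<open>t > 0\<close>.\<close>

definition transform_solution ::
    "nat \<Rightarrow> (nat \<Rightarrow> real) \<Rightarrow> (nat \<Rightarrow> real) \<Rightarrow> real \<Rightarrow> real \<Rightarrow> (real \<Rightarrow> (real ^ 'n) measure) \<Rightarrow> bool" where
  "transform_solution m \<nu> lam \<beta> c w \<longleftrightarrow>
     (\<forall>\<xi>. fourier (w 0) \<xi> = 1 \<and> continuous (at_right 0) (\<lambda>t. fourier (w t) \<xi>)) \<and>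
     (\<forall>\<xi>. \<forall>\<mu>>0. laplace_exists (\<lambda>t. fourier (w t) \<xi>) \<mu> \<and>
        (let W = laplace (\<lambda>t. fourier (w t) \<xi>) \<mu> in
          (\<Sum>j=1..m. of_real (lam j) * (of_real (\<mu> powr \<nu> j) * W - of_real (\<mu> powr (\<nu> j - 1))))
            = - of_real (c\<^sup>2 * norm \<xi> powr (2 * \<beta>)) * W))"

end

(* Write A(s) for the weighted sum of the subordinators, so that E exp(-mu A(s)) = exp(-s Phi(mu))
   with Phi(mu) = sum_j lambda_j mu^nu_j, and L(t) for its first passage time. Almost surely A is
   nondecreasing, right-continuous and unbounded, hence L(t) <= s iff t <= A(s). Writing
   exp(-k L(t)) as the integral of k exp(-k s) over {s. L(t) <= s} = {s. t <= A(s)} and exchanging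
   integrals, the Laplace transform of t |-> E exp(-k L(t)) is Phi(mu) / (mu (k + Phi(mu))).
   Conditioning on L turns the characteristic function of S(c^2 L(t)) at xi into E exp(-k L(t)) with
   k = c^2 |xi|^(2 beta); inserting the Laplace transform gives the transformed equation. *)
theory Submission
  imports Defs "HOL-Real_Asymp.Real_Asymp"
begin

text \<open>The pathwise hypotheses on a subordinator are only a start at 0, nonnegativity and
  cadlag regularity; monotonicity, strict positivity and unboundedness must be extracted almost
  surely from its laws. Two measurability obstacles shape the rest. The event t \<le> A(s) has to be
  measurable jointly in t, s and \<omega> before integrals may be exchanged; right-continuity
  reduces it to rational times. And the time change inserts a random time, measurable only for the
  completed measure, into a process known to be measurable only at each fixed time; here S is
  sampled at the next point of a deterministic grid, where independence factors a finite sum, and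
  right-continuity with dominated convergence refines the grid, so that no conditional expectation
  is formed. At \<xi> = 0 one has k = 0 and the density k exp(-k s) degenerates, so that frequency
  is treated apart. With W = Phi / (\<mu> (k + Phi)) the transformed equation is the identity Phi (W
  - 1 / \<mu>) = - k W.\<close>

subsection \<open>Paths of subordinators\<close>

text \<open>What a path must satisfy for its first passage times to behave. Monotonicity and
  right-continuity make the infimum of passage attained, unboundedness keeps it away from the
  uninformative \<open>Inf {}\<close>, and strict positivity lets passage times tend to 0 with the
  level, which the initial condition needs.\<close>

definition regular_path :: "(real \<Rightarrow> real) \<Rightarrow> bool" where
  "regular_path f \<longleftrightarrow>
     (\<forall>s t. 0 \<le> s \<longrightarrow> s \<le> t \<longrightarrow> f s \<le> f t) \<and>
     (\<forall>t\<ge>0. continuous (at_right t) f) \<and>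
     (\<forall>t\<ge>0. 0 \<le> f t) \<and>
     (\<forall>s>0. 0 < f s) \<and>
     (\<forall>y. \<exists>s>0. y \<le> f s)"

text \<open>An almost sure comparison of two times has its own exceptional null set, so only
  countably many pairs can be combined. Right-continuity at both ends then carries the order from
  rational to real times.\<close>

lemma mono_of_mono_rat:
  fixes f :: "real \<Rightarrow> real"
  assumes rat: "\<And>p q::rat. 0 \<le> p \<Longrightarrow> p \<le> q \<Longrightarrow> f (of_rat p) \<le> f (of_rat q)"
    and cont: "\<And>t. 0 \<le> t \<Longrightarrow> continuous (at_right t) f"
    and st: "0 \<le> s" "s \<le> t"
  shows "f s \<le> f t"
proof (cases "s = t")
  case False
  have lim: "(f \<longlongrightarrow> f u) (at_right u)" if "0 \<le> u" for u
    using cont[OF that] by (simp add: continuous_within)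
  have low: "f s \<le> f (of_rat q)" if q: "t < of_rat q" for q :: rat
  proof (rule ccontr)
    assume "\<not> f s \<le> f (of_rat q)"
    then have "\<forall>\<^sub>F x in at_right s. f (of_rat q) < f x"
      by (intro order_tendstoD(1)[OF lim[OF st(1)]]) auto
    then obtain b where b: "b > s" "\<And>x. s < x \<Longrightarrow> x < b \<Longrightarrow> f (of_rat q) < f x"
      unfolding eventually_at_right_field by auto
    obtain p :: rat where p: "s < of_rat p" "of_rat p < min b (of_rat q)"
      using of_rat_dense[of s "min b (of_rat q)"] b(1) st q by auto
    have "of_rat 0 < (of_rat p :: real)" "of_rat p < (of_rat q :: real)"
      using p st(1) unfolding of_rat_0 by linarith+
    then have p0: "0 \<le> p" "p \<le> q"
      unfolding of_rat_less by auto
    show False using b(2)[of "of_rat p"] p rat[OF p0] by auto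
  qed
  show ?thesis
  proof (rule ccontr)
    assume "\<not> f s \<le> f t"
    then have "\<forall>\<^sub>F x in at_right t. f x < f s"
      using st by (intro order_tendstoD(2)[OF lim[of t]]) auto
    then obtain b where b: "b > t" "\<And>x. t < x \<Longrightarrow> x < b \<Longrightarrow> f x < f s"
      unfolding eventually_at_right_field by auto
    obtain p :: rat where p: "t < of_rat p" "of_rat p < b"
      using of_rat_dense[of t b] b(1) by auto
    show False using b(2)[OF p] low[OF p(1)] by simp
  qed
qed simp

lemma regular_path_sum:
  fixes f :: "nat \<Rightarrow> real \<Rightarrow> real"
  assumes "1 \<le> m" and "\<And>j. j \<in> {1..m} \<Longrightarrow> 0 < a j" and "\<And>j. j \<in> {1..m} \<Longrightarrow> regular_path (f j)"
  shows "regular_path (\<lambda>s. \<Sum>j=1..m. a j * f j s)"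
  unfolding regular_path_def
proof (intro conjI allI impI)
  fix s t :: real assume "0 \<le> s" "s \<le> t"
  then show "(\<Sum>j=1..m. a j * f j s) \<le> (\<Sum>j=1..m. a j * f j t)"
    using assms by (intro sum_mono mult_left_mono) (auto simp: regular_path_def less_imp_le)
next
  fix t :: real assume "0 \<le> t"
  then show "continuous (at_right t) (\<lambda>s. \<Sum>j=1..m. a j * f j s)"
    using assms by (intro continuous_sum continuous_mult continuous_const) (auto simp: regular_path_def)
  from \<open>0 \<le> t\<close> show "0 \<le> (\<Sum>j=1..m. a j * f j t)"
    using assms by (intro sum_nonneg mult_nonneg_nonneg) (auto simp: regular_path_def less_imp_le)
next
  fix s :: real assume "0 < s"
  then show "0 < (\<Sum>j=1..m. a j * f j s)"
    using assms by (intro sum_pos mult_pos_pos) (auto simp: regular_path_def)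
next
  fix y :: real
  \<comment> \<open>One unbounded summand suffices, since the weights are positive and the other
    summands nonnegative.\<close>
  have m: "1 \<in> {1..m}" using assms(1) by auto
  obtain s where s: "0 < s" "y / a 1 \<le> f 1 s"
    using assms(3)[OF m] unfolding regular_path_def by blast
  have "y \<le> a 1 * f 1 s"
    using s assms(2)[OF m] by (simp add: field_simps)
  also have "\<dots> = (\<Sum>j\<in>{1}. a j * f j s)" by simp
  also have "\<dots> \<le> (\<Sum>j=1..m. a j * f j s)"
    using assms m s by (intro sum_mono2 mult_nonneg_nonneg) (auto simp: regular_path_def less_imp_le)
  finally show "\<exists>s>0. y \<le> (\<Sum>j=1..m. a j * f j s)" using s(1) by blast
qed

text \<open>The pointwise infimum is nonnegative and its integral lies below that of every
  \<open>X n\<close>, hence is 0. This turns limits of Laplace transforms into pathwise statements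
  without passing to subsequences.\<close>

lemma AE_not_all_ge:
  fixes X :: "nat \<Rightarrow> 'a \<Rightarrow> real"
  assumes [measurable]: "\<And>n. X n \<in> borel_measurable M"
    and X: "\<And>n. AE x in M. 0 \<le> X n x" "\<And>n. integrable M (X n)"
    and lim: "(\<lambda>n. LINT x|M. X n x) \<longlonglongrightarrow> 0"
  shows "AE x in M. \<forall>\<epsilon>>0. \<exists>n. X n x < \<epsilon>"
proof -
  have le: "(\<integral>\<^sup>+x. (INF n. ennreal (X n x)) \<partial>M) \<le> ennreal (LINT x|M. X n x)" for n
    using X by (subst nn_integral_eq_integral[symmetric])
      (auto intro!: nn_integral_mono INF_lower)
  have "(\<lambda>n. ennreal (LINT x|M. X n x)) \<longlonglongrightarrow> ennreal 0"
    by (rule tendsto_ennrealI[OF lim])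
  then have "(\<integral>\<^sup>+x. (INF n. ennreal (X n x)) \<partial>M) \<le> 0"
    unfolding ennreal_0 using le by (intro LIMSEQ_le_const) auto
  then have "AE x in M. (INF n. ennreal (X n x)) = 0"
    by (subst (asm) le_zero_eq, subst (asm) nn_integral_0_iff_AE) auto
  then show ?thesis
  proof eventually_elim
    case (elim x)
    show ?case
    proof (intro allI impI)
      fix \<epsilon> :: real assume "0 < \<epsilon>"
      then have "(INF n. ennreal (X n x)) < ennreal \<epsilon>" using elim by simp
      then obtain n where "ennreal (X n x) < ennreal \<epsilon>" by (auto simp: INF_less_iff)
      then have "X n x < \<epsilon>"
        by (metis \<open>0 < \<epsilon>\<close> ennreal_leI linorder_not_less)
      then show "\<exists>n. X n x < \<epsilon>" ..
    qed
  qed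
qed

text \<open>An increment over [s, t] has the law of H(t - s) - H(0), which is almost surely
  nonnegative. Positivity at a fixed time comes from exp(-t \<mu>^\<nu>) tending to 0 as \<mu>
  grows, unboundedness from the same limit as t grows. By monotonicity the times 1 / (k + 1) suffice
  for positivity.\<close>

lemma (in prob_space) AE_regular_path_subordinator:
  assumes H: "stable_subordinator M \<nu> H" and \<nu>: "0 < \<nu>"
  shows "AE \<omega> in M. regular_path (\<lambda>t. H t \<omega>)"
proof -
  have levy: "levy_process M H" and nonneg: "AE \<omega> in M. \<forall>t\<ge>0. 0 \<le> H t \<omega>"
    and lap: "\<And>t \<mu>. 0 \<le> t \<Longrightarrow> 0 < \<mu> \<Longrightarrow> (LINT \<omega>|M. exp (- \<mu> * H t \<omega>)) = exp (- t * \<mu> powr \<nu>)"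
    using H by (auto simp: stable_subordinator_def)
  have meas[measurable]: "H t \<in> borel_measurable M" if "0 \<le> t" for t
    using levy that by (auto simp: levy_process_def)
  have stat: "distr M borel (\<lambda>\<omega>. H (s + h) \<omega> - H s \<omega>) = distr M borel (\<lambda>\<omega>. H h \<omega> - H 0 \<omega>)"
    if "0 \<le> s" "0 \<le> h" for s h
    using levy that by (simp add: levy_process_def)
  have zero: "AE \<omega> in M. H 0 \<omega> = 0"
    using levy by (simp add: levy_process_def)
  have inc: "AE \<omega> in M. H s \<omega> \<le> H t \<omega>" if "0 \<le> s" "s \<le> t" for s t
  proof -
    have d: "distr M borel (\<lambda>\<omega>. H t \<omega> - H s \<omega>) = distr M borel (\<lambda>\<omega>. H (t - s) \<omega> - H 0 \<omega>)"
      using stat[of s "t - s"] that by simp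
    have "AE \<omega> in M. 0 \<le> H (t - s) \<omega> - H 0 \<omega>"
      using nonneg zero by eventually_elim (use that in auto)
    then have "AE x in distr M borel (\<lambda>\<omega>. H (t - s) \<omega> - H 0 \<omega>). 0 \<le> x"
      using that by (subst AE_distr_iff) auto
    then have "AE \<omega> in M. 0 \<le> H t \<omega> - H s \<omega>"
      using that unfolding d[symmetric] by (subst (asm) AE_distr_iff) auto
    then show ?thesis by auto
  qed
  have "AE \<omega> in M. 0 \<le> p \<longrightarrow> p \<le> q \<longrightarrow> H (of_rat p) \<omega> \<le> H (of_rat q) \<omega>" for p q :: rat
    using inc[of "of_rat p" "of_rat q"]
    by (cases "0 \<le> p \<and> p \<le> q") (auto simp: of_rat_less_eq zero_le_of_rat_iff)
  then have rat: "AE \<omega> in M. \<forall>p q::rat. 0 \<le> p \<longrightarrow> p \<le> q \<longrightarrow> H (of_rat p) \<omega> \<le> H (of_rat q) \<omega>"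
    by (simp add: AE_all_countable)
  have int: "integrable M (\<lambda>\<omega>. exp (- \<mu> * H t \<omega>))" if "0 \<le> t" "0 < \<mu>" for t \<mu>
    using that nonneg by (intro integrable_const_bound[where B=1]) auto
  have pos: "AE \<omega> in M. 0 < H (1 / real (Suc k)) \<omega>" for k
  proof -
    have "(\<lambda>n. exp (- (1 / real (Suc k)) * real (Suc n) powr \<nu>)) \<longlonglongrightarrow> 0"
      using \<nu> by real_asymp
    then have "(\<lambda>n. LINT \<omega>|M. exp (- real (Suc n) * H (1 / real (Suc k)) \<omega>)) \<longlonglongrightarrow> 0"
      by (subst lap) auto
    then have "AE \<omega> in M. \<forall>\<epsilon>>0. \<exists>n. exp (- real (Suc n) * H (1 / real (Suc k)) \<omega>) < \<epsilon>"
      using int by (intro AE_not_all_ge) (auto simp: lap simp del: of_nat_Suc)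
    then show ?thesis
    proof eventually_elim
      case (elim \<omega>)
      \<comment> \<open>The threshold is 1: a value H \<le> 0 would keep all these exponentials at
        least 1.\<close>
      then obtain n where "exp (- real (Suc n) * H (1 / real (Suc k)) \<omega>) < exp 0"
        by (metis exp_gt_zero)
      then show ?case unfolding exp_less_cancel_iff by (simp add: zero_less_mult_iff del: of_nat_Suc)
    qed
  qed
  then have pos: "AE \<omega> in M. \<forall>k. 0 < H (1 / real (Suc k)) \<omega>"
    by (simp only: AE_all_countable) blast
  \<comment> \<open>At \<mu> = 1 the Laplace transform at time n + 1 is exp(-(n + 1)) for every
    order, because 1 powr \<nu> = 1.\<close>
  have "(\<lambda>n. exp (- real (Suc n))) \<longlonglongrightarrow> 0" by real_asymp
  then have unb: "AE \<omega> in M. \<forall>\<epsilon>>0. \<exists>n. exp (- 1 * H (real (Suc n)) \<omega>) < \<epsilon>"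
    using int[of _ 1] lap[of _ 1] by (intro AE_not_all_ge) (auto simp del: of_nat_Suc)
  have cadlag: "AE \<omega> in M. cadlag (\<lambda>t. H t \<omega>)"
    using levy by (simp add: levy_process_def)
  from rat pos unb cadlag nonneg show ?thesis
  proof eventually_elim
    case (elim \<omega>)
    have cont: "\<And>t. 0 \<le> t \<Longrightarrow> continuous (at_right t) (\<lambda>t. H t \<omega>)"
      using elim by (simp add: cadlag_def)
    have mono: "H s \<omega> \<le> H t \<omega>" if "0 \<le> s" "s \<le> t" for s t
      using mono_of_mono_rat[of "\<lambda>t. H t \<omega>", OF _ cont that] elim(1) by blast
    show ?case unfolding regular_path_def
    proof (intro conjI allI impI)
      fix s :: real assume "0 < s"
      then obtain k where k: "1 / real (Suc k) < s"
        using nat_approx_posE by auto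
      then have "H (1 / real (Suc k)) \<omega> \<le> H s \<omega>" by (intro mono) auto
      then show "0 < H s \<omega>" using elim(2) by (meson less_le_trans)
    next
      fix y :: real
      obtain n where "exp (- 1 * H (real (Suc n)) \<omega>) < exp (- y)"
        using elim(3) by (metis exp_gt_zero)
      then show "\<exists>s>0. y \<le> H s \<omega>" by (intro exI[of _ "real (Suc n)"]) auto
    qed (use mono cont elim(5) in auto)
  qed
qed

subsection \<open>First passage times\<close>

lemma regular_path_nonneg: "regular_path f \<Longrightarrow> 0 \<le> s \<Longrightarrow> 0 \<le> f s"
  by (simp add: regular_path_def)

text \<open>Monotonicity gives one direction, approach from the right the other. The countable
  quantifier over rational times serves both the attainment of the infimum and joint
  measurability.\<close>

lemma regular_path_ge_iff_rat:
  assumes f: "regular_path f" and s: "0 \<le> s"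
  shows "t \<le> f s \<longleftrightarrow> (\<forall>q::rat. s < of_rat q \<longrightarrow> t \<le> f (of_rat q))"
proof
  assume "t \<le> f s"
  then show "\<forall>q::rat. s < of_rat q \<longrightarrow> t \<le> f (of_rat q)"
    using f s unfolding regular_path_def by (meson less_imp_le order_trans)
next
  assume R: "\<forall>q::rat. s < of_rat q \<longrightarrow> t \<le> f (of_rat q)"
  show "t \<le> f s"
  proof (rule ccontr)
    assume "\<not> t \<le> f s"
    moreover have "(f \<longlongrightarrow> f s) (at_right s)"
      using f s by (simp add: regular_path_def continuous_within)
    ultimately have "\<forall>\<^sub>F x in at_right s. f x < t"
      by (intro order_tendstoD(2)) auto
    then obtain b where b: "b > s" "\<And>x. s < x \<Longrightarrow> x < b \<Longrightarrow> f x < t"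
      unfolding eventually_at_right_field by auto
    obtain q :: rat where q: "s < of_rat q" "of_rat q < b"
      using of_rat_dense[OF b(1)] by auto
    show False using b(2)[OF q] R q(1) by fastforce
  qed
qed

lemma first_passage_nonneg:
  assumes "regular_path f"
  shows "0 \<le> Inf {s. 0 < s \<and> t \<le> f s}"
proof (rule cInf_greatest)
  show "{s. 0 < s \<and> t \<le> f s} \<noteq> {}"
    using assms unfolding regular_path_def by blast
qed auto

text \<open>Monotonicity makes the set of passage upward closed, and right-continuity puts its
  infimum into the condition t \<le> f(s). The equivalence includes s = 0 although the infimum runs
  over positive times only.\<close>

lemma first_passage_le_iff:
  assumes f: "regular_path f" and s: "0 \<le> s"
  shows "Inf {s. 0 < s \<and> t \<le> f s} \<le> s \<longleftrightarrow> t \<le> f s"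
proof -
  let ?I = "{s. 0 < s \<and> t \<le> f s}"
  have bdd: "bdd_below ?I" by (rule bdd_belowI[of _ 0]) auto
  have ne: "?I \<noteq> {}" using f unfolding regular_path_def by blast
  have mono: "f a \<le> f b" if "0 \<le> a" "a \<le> b" for a b
    using f that by (simp add: regular_path_def)
  show ?thesis
  proof
    assume L: "Inf ?I \<le> s"
    show "t \<le> f s"
      unfolding regular_path_ge_iff_rat[OF f s]
    proof (intro allI impI)
      fix q :: rat assume "s < of_rat q"
      then have "Inf ?I < of_rat q" using L by simp
      then obtain r where "r \<in> ?I" "r < of_rat q"
        using cInf_lessD[OF ne] by blast
      then show "t \<le> f (of_rat q)" using mono[of r "of_rat q"] by simp
    qed
  next
    assume t: "t \<le> f s"
    show "Inf ?I \<le> s"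
    \<comment> \<open>The time s may be 0 and then lies outside the set, whereas s + e always
      belongs to it.\<close>
    proof (rule field_le_epsilon)
      fix e :: real assume "0 < e"
      then show "Inf ?I \<le> s + e"
        using s t mono[of s "s + e"] by (intro cInf_lower[OF _ bdd]) auto
    qed
  qed
qed

text \<open>Everything is nonnegative, so Tonelli applies without integrability conditions. A single
  \<mu> is fixed, and \<Phi> is the Laplace exponent of \<open>A\<close> at that \<mu>. The value
  arises as (1 - k / (k + \<Phi>)) / \<mu>.\<close>

lemma (in prob_space) laplace_first_passage:
  fixes A :: "real \<Rightarrow> 'a \<Rightarrow> real"
  assumes meas: "\<And>s. 0 \<le> s \<Longrightarrow> A s \<in> borel_measurable M"
    and reg: "AE \<omega> in M. regular_path (\<lambda>s. A s \<omega>)"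
    and lap: "\<And>s. 0 \<le> s \<Longrightarrow> (LINT \<omega>|M. exp (- \<mu> * A s \<omega>)) = exp (- s * \<Phi>)"
    and pos: "0 < k" "0 < \<mu>" "0 < \<Phi>"
  defines "L \<equiv> \<lambda>t \<omega>. Inf {s. 0 < s \<and> t \<le> A s \<omega>}"
  shows "(\<lambda>t. \<integral>\<^sup>+\<omega>. ennreal (exp (- k * L t \<omega>)) \<partial>M) \<in> borel_measurable borel" (is ?meas)
    and "(\<integral>\<^sup>+t. ennreal (exp (- \<mu> * t)) * indicator {0<..} t * (\<integral>\<^sup>+\<omega>. ennreal (exp (- k * L t \<omega>)) \<partial>M) \<partial>lborel)
           = ennreal (\<Phi> / (\<mu> * (k + \<Phi>)))" (is "?lhs = _")
proof -
  \<comment> \<open>By right-continuity \<open>P t s \<omega>\<close> is almost surely \<open>t \<le> A s \<omega>\<close>; restricting to rational times makes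
    it jointly measurable on the whole space.\<close>
  define P where "P t s \<omega> \<longleftrightarrow> (\<forall>q::rat. 0 \<le> q \<longrightarrow> s < of_rat q \<longrightarrow> t \<le> A (max 0 (of_rat q)) \<omega>)" for t s :: real and \<omega>
  \<comment> \<open>The truncation keeps every time in the range where \<open>A\<close> is known to
    be measurable, and it changes nothing for q \<ge> 0.\<close>
  have [measurable]: "A (max 0 q) \<in> borel_measurable M" for q by (rule meas) simp
  have P: "P t s \<omega> \<longleftrightarrow> t \<le> A s \<omega>" if r: "regular_path (\<lambda>s. A s \<omega>)" and "0 \<le> s" for t s :: real and \<omega>
  proof -
    have "0 \<le> q \<and> max 0 (real_of_rat q) = of_rat q" if "s < of_rat q" for q
    proof -
      have "0 < real_of_rat q" using that \<open>0 \<le> s\<close> by linarith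
      then show ?thesis by simp
    qed
    then show ?thesis
      unfolding P_def regular_path_ge_iff_rat[OF that] by metis
  qed
  define D :: "real \<Rightarrow> real \<Rightarrow> 'a \<Rightarrow> ennreal"
    where "D t s \<omega> = (if P t s \<omega> then 1 else 0)" for t s :: real and \<omega>
  have D_meas[measurable]: "(\<lambda>x. D (a x) (b x) (c x)) \<in> borel_measurable N"
    if [measurable]: "a \<in> borel_measurable N" "b \<in> borel_measurable N" "c \<in> measurable N M"
    for a b c and N :: "'z measure"
    unfolding D_def P_def by measurable
  \<comment> \<open>\<open>G\<close> is the exponential density of rate k and \<open>E\<close> the
    Laplace kernel. The closed half-line in \<open>E\<close> differs from the open one in the goal
    by the null set {0}.\<close>
  define G :: "real \<Rightarrow> ennreal" where "G s = ennreal (k * exp (- k * s)) * indicator {0..} s" for s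
  define E :: "real \<Rightarrow> ennreal" where "E t = ennreal (exp (- \<mu> * t)) * indicator {0..} t" for t
  have [measurable]: "G \<in> borel_measurable borel" "E \<in> borel_measurable borel"
    unfolding G_def E_def by measurable
  have exp_L: "AE \<omega> in M. ennreal (exp (- k * L t \<omega>)) = (\<integral>\<^sup>+s. G s * D t s \<omega> \<partial>lborel)" for t
    using reg
  proof eventually_elim
    case (elim \<omega>)
    have L0: "0 \<le> L t \<omega>" unfolding L_def by (rule first_passage_nonneg[OF elim])
    have "G s * D t s \<omega> = ennreal (k * exp (- k * s)) * indicator {L t \<omega>..} s" for s
    proof (cases "0 \<le> s")
      case True
      then show ?thesis
        using first_passage_le_iff[OF elim True, of t] P[OF elim True, of t]
        by (auto simp: G_def D_def L_def)
    qed (use L0 in \<open>auto simp: G_def\<close>)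
    then have "(\<integral>\<^sup>+s. G s * D t s \<omega> \<partial>lborel) = (\<integral>\<^sup>+s. ennreal (k * exp (- k * s)) * indicator {L t \<omega>..} s \<partial>lborel)"
      by simp
    also have "\<dots> = ennreal (0 - (- exp (- k * L t \<omega>)))"
    proof (rule nn_integral_FTC_atLeast)
      show "((\<lambda>s. - exp (- k * s)) \<longlongrightarrow> 0) at_top"
        using pos by real_asymp
    qed (use pos in \<open>auto intro!: derivative_eq_intros\<close>)
    finally show ?case by simp
  qed
  \<comment> \<open>\<open>L t\<close> need not be measurable for \<open>M\<close>;
    \<open>nn_integral\<close> still agrees on almost everywhere equal integrands, and the
    right-hand side is measurable in t.\<close>
  have \<phi>: "(\<integral>\<^sup>+\<omega>. ennreal (exp (- k * L t \<omega>)) \<partial>M) = (\<integral>\<^sup>+\<omega>. (\<integral>\<^sup>+s. G s * D t s \<omega> \<partial>lborel) \<partial>M)" for t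
    by (rule nn_integral_cong_AE[OF exp_L])
  show ?meas unfolding \<phi> by measurable
  interpret p: pair_sigma_finite lborel M ..
  interpret q: pair_sigma_finite M lborel ..
  have inner: "(\<integral>\<^sup>+t. E t * D t s \<omega> \<partial>lborel) = ennreal ((1 - exp (- \<mu> * A s \<omega>)) / \<mu>)"
    if r: "regular_path (\<lambda>s. A s \<omega>)" and s: "0 \<le> s" for s \<omega>
  proof -
    have "(\<integral>\<^sup>+t. E t * D t s \<omega> \<partial>lborel) = (\<integral>\<^sup>+t. ennreal (exp (- \<mu> * t)) * indicator {0..A s \<omega>} t \<partial>lborel)"
      by (intro nn_integral_cong) (auto simp: E_def D_def P[OF r s] split: split_indicator)
    also have "\<dots> = ennreal ((- exp (- \<mu> * A s \<omega>) / \<mu>) - (- exp (- \<mu> * 0) / \<mu>))"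
      using pos regular_path_nonneg[OF r s]
      by (intro nn_integral_FTC_Icc) (auto intro!: derivative_eq_intros)
    finally show ?thesis by (simp add: diff_divide_distrib)
  qed
  have mid: "(\<integral>\<^sup>+\<omega>. (\<integral>\<^sup>+t. E t * D t s \<omega> \<partial>lborel) \<partial>M) = ennreal ((1 - exp (- s * \<Phi>)) / \<mu>)"
    if s: "0 \<le> s" for s
  proof -
    note [measurable] = meas[OF s]
    have nonneg: "AE \<omega> in M. 0 \<le> A s \<omega>"
      using reg by eventually_elim (rule regular_path_nonneg[OF _ s])
    have int: "integrable M (\<lambda>\<omega>. exp (- \<mu> * A s \<omega>))"
      using nonneg pos by (intro integrable_const_bound[where B=1]) auto
    have "(\<integral>\<^sup>+\<omega>. (\<integral>\<^sup>+t. E t * D t s \<omega> \<partial>lborel) \<partial>M) = (\<integral>\<^sup>+\<omega>. ennreal ((1 - exp (- \<mu> * A s \<omega>)) / \<mu>) \<partial>M)"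
    proof (rule nn_integral_cong_AE)
      show "AE \<omega> in M. (\<integral>\<^sup>+t. E t * D t s \<omega> \<partial>lborel) = ennreal ((1 - exp (- \<mu> * A s \<omega>)) / \<mu>)"
        using reg by eventually_elim (rule inner[OF _ s])
    qed
    also have "\<dots> = ennreal (LINT \<omega>|M. (1 - exp (- \<mu> * A s \<omega>)) / \<mu>)"
      using nonneg pos int by (intro nn_integral_eq_integral) auto
    also have "(LINT \<omega>|M. (1 - exp (- \<mu> * A s \<omega>)) / \<mu>) = (1 - exp (- s * \<Phi>)) / \<mu>"
      using int lap[OF s] by (simp add: prob_space)
    finally show ?thesis .
  qed
  have "?lhs = (\<integral>\<^sup>+t. E t * (\<integral>\<^sup>+\<omega>. (\<integral>\<^sup>+s. G s * D t s \<omega> \<partial>lborel) \<partial>M) \<partial>lborel)"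
    unfolding \<phi>
  proof (rule nn_integral_cong_AE)
    show "AE t in lborel. ennreal (exp (- \<mu> * t)) * indicator {0<..} t * (\<integral>\<^sup>+\<omega>. (\<integral>\<^sup>+s. G s * D t s \<omega> \<partial>lborel) \<partial>M)
        = E t * (\<integral>\<^sup>+\<omega>. (\<integral>\<^sup>+s. G s * D t s \<omega> \<partial>lborel) \<partial>M)"
      using AE_lborel_singleton[of 0]
      by eventually_elim (auto simp: E_def split: split_indicator)
  qed
  \<comment> \<open>The order t, \<omega>, s is turned into s, \<omega>, t by three swaps of
    adjacent variables, with the factors \<open>E t\<close> and \<open>G s\<close> moved out of the
    way in between.\<close>
  also have "\<dots> = (\<integral>\<^sup>+t. E t * (\<integral>\<^sup>+s. (\<integral>\<^sup>+\<omega>. G s * D t s \<omega> \<partial>M) \<partial>lborel) \<partial>lborel)"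
    by (subst p.Fubini') simp_all
  also have "\<dots> = (\<integral>\<^sup>+t. (\<integral>\<^sup>+s. G s * (\<integral>\<^sup>+\<omega>. E t * D t s \<omega> \<partial>M) \<partial>lborel) \<partial>lborel)"
    by (simp add: nn_integral_cmult nn_integral_cmult[symmetric] mult.left_commute del: nn_integral_cmult)
  also have "\<dots> = (\<integral>\<^sup>+s. (\<integral>\<^sup>+t. G s * (\<integral>\<^sup>+\<omega>. E t * D t s \<omega> \<partial>M) \<partial>lborel) \<partial>lborel)"
    by (rule lborel_pair.Fubini') measurable
  also have "\<dots> = (\<integral>\<^sup>+s. G s * (\<integral>\<^sup>+t. (\<integral>\<^sup>+\<omega>. E t * D t s \<omega> \<partial>M) \<partial>lborel) \<partial>lborel)"
    by (simp add: nn_integral_cmult)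
  also have "\<dots> = (\<integral>\<^sup>+s. G s * (\<integral>\<^sup>+\<omega>. (\<integral>\<^sup>+t. E t * D t s \<omega> \<partial>lborel) \<partial>M) \<partial>lborel)"
    by (subst q.Fubini') simp_all
  also have "\<dots> = (\<integral>\<^sup>+s. ennreal (k * exp (- k * s) * ((1 - exp (- s * \<Phi>)) / \<mu>)) * indicator {0..} s \<partial>lborel)"
  proof (rule nn_integral_cong)
    fix s :: real
    show "G s * (\<integral>\<^sup>+\<omega>. (\<integral>\<^sup>+t. E t * D t s \<omega> \<partial>lborel) \<partial>M)
        = ennreal (k * exp (- k * s) * ((1 - exp (- s * \<Phi>)) / \<mu>)) * indicator {0..} s"
    proof (cases "0 \<le> s")
      case True
      then have "0 \<le> (1 - exp (- s * \<Phi>)) / \<mu>" using pos by simp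
      then show ?thesis
        using True pos unfolding mid[OF True] G_def by (subst ennreal_mult) simp_all
    qed (simp add: G_def)
  qed
  \<comment> \<open>The antiderivative comes from expanding the integrand into (k exp(-k s) - k
    exp(-(k + \<Phi>) s)) / \<mu>.\<close>
  also have "\<dots> = ennreal (0 - (- exp (- k * 0) + k / (k + \<Phi>) * exp (- (k + \<Phi>) * 0)) / \<mu>)"
  proof (rule nn_integral_FTC_atLeast)
    show "((\<lambda>s. (- exp (- k * s) + k / (k + \<Phi>) * exp (- (k + \<Phi>) * s)) / \<mu>) \<longlongrightarrow> 0) at_top"
    proof -
      have lim: "((\<lambda>s. exp (- a * s)) \<longlongrightarrow> 0) at_top" if "0 < a" for a :: real
        using that by real_asymp
      have "((\<lambda>s. (- exp (- k * s) + k / (k + \<Phi>) * exp (- (k + \<Phi>) * s)) / \<mu>)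
          \<longlongrightarrow> (- 0 + k / (k + \<Phi>) * 0) / \<mu>) at_top"
        using pos by (intro tendsto_divide tendsto_add tendsto_minus tendsto_mult tendsto_const lim) auto
      then show ?thesis by simp
    qed
    show "((\<lambda>s. (- exp (- k * s) + k / (k + \<Phi>) * exp (- (k + \<Phi>) * s)) / \<mu>) has_real_derivative
            k * exp (- k * s) * ((1 - exp (- s * \<Phi>)) / \<mu>)) (at s)" for s
    proof -
      define e where "e = k + \<Phi>"
      have e: "e \<noteq> 0" using pos by (simp add: e_def)
      have "((\<lambda>s. (- exp (- k * s) + k / e * exp (- e * s)) / \<mu>) has_real_derivative
            (k * exp (- k * s) + k / e * (- e * exp (- e * s))) / \<mu>) (at s)"
        using pos by (auto intro!: derivative_eq_intros)
      moreover have "exp (- e * s) = exp (- k * s) * exp (- s * \<Phi>)"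
        by (simp add: e_def exp_add[symmetric] algebra_simps)
      then have "(k * exp (- k * s) + k / e * (- e * exp (- e * s))) / \<mu>
          = k * exp (- k * s) * ((1 - exp (- s * \<Phi>)) / \<mu>)"
        using e by (simp add: algebra_simps)
      ultimately show ?thesis unfolding e_def by (rule DERIV_cong)
    qed
  qed (use pos in auto)
  also have "0 - (- exp (- k * 0) + k / (k + \<Phi>) * exp (- (k + \<Phi>) * 0)) / \<mu> = \<Phi> / (\<mu> * (k + \<Phi>))"
  proof -
    have "k + \<Phi> \<noteq> 0" using pos by simp
    then show ?thesis using pos by (simp add: field_simps)
  qed
  finally show "?lhs = ennreal (\<Phi> / (\<mu> * (k + \<Phi>)))" .
qed

subsection \<open>Random time change\<close>

text \<open>The cells of width 1 / n are disjoint and x lies in the one of index floor(n x), so at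
  most one term survives; 0 is the value when that index is beyond the N cells.\<close>

lemma sum_grid_cells:
  fixes f :: "nat \<Rightarrow> 'b::real_vector" and x :: real
  assumes x: "0 \<le> x" and n: "0 < n"
  shows "(\<Sum>k<N. indicat_real {real k / real n..<(real k + 1) / real n} x *\<^sub>R f k)
           = (if nat \<lfloor>real n * x\<rfloor> < N then f (nat \<lfloor>real n * x\<rfloor>) else 0)"
proof -
  have "x \<in> {real k / real n..<(real k + 1) / real n} \<longleftrightarrow> k = nat \<lfloor>real n * x\<rfloor>" for k
  proof -
    have "x \<in> {real k / real n..<(real k + 1) / real n} \<longleftrightarrow> real k \<le> real n * x \<and> real n * x < real k + 1"
      using n by (simp add: field_simps)
    also have "\<dots> \<longleftrightarrow> \<lfloor>real n * x\<rfloor> = int k"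
      by (simp add: floor_eq_iff)
    also have "\<dots> \<longleftrightarrow> k = nat \<lfloor>real n * x\<rfloor>"
      using x n by (auto simp: zero_le_floor)
    finally show ?thesis .
  qed
  then have "(\<Sum>k<N. indicat_real {real k / real n..<(real k + 1) / real n} x *\<^sub>R f k)
      = (\<Sum>k<N. if k = nat \<lfloor>real n * x\<rfloor> then f k else 0)"
    by (intro sum.cong) (simp_all add: indicator_def)
  then show ?thesis by simp
qed

text \<open>The value of \<open>f\<close> at the first point of the grid \<open>\<nat> / (n + 1)\<close> to the right of \<open>x\<close>, and \<open>0\<close>
  when \<open>x \<ge> n + 1\<close>.\<close>

definition grid_sample :: "(real \<Rightarrow> 'b::real_normed_vector) \<Rightarrow> nat \<Rightarrow> real \<Rightarrow> 'b" where
  "grid_sample f n x =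
     (\<Sum>k<(Suc n)\<^sup>2. indicat_real {real k / real (Suc n)..<(real k + 1) / real (Suc n)} x
        *\<^sub>R f ((real k + 1) / real (Suc n)))"

lemma norm_grid_sample_le:
  assumes "0 \<le> x" "\<And>t. 0 \<le> t \<Longrightarrow> norm (f t) \<le> B"
  shows "norm (grid_sample f n x) \<le> B"
  \<comment> \<open>The bound at time 0 yields 0 \<le> B, which covers points beyond the
    grid.\<close>
  using assms order_trans[OF norm_ge_zero assms(2)[of 0]]
  unfolding grid_sample_def by (subst sum_grid_cells) auto

text \<open>The sample point is the right end of the cell: strictly larger than x and within 1 / (n
  + 1) of it. It therefore converges inside \<open>at_right x\<close>; left ends would call for
  left-continuity.\<close>

lemma grid_sample_LIMSEQ:
  assumes x: "0 \<le> x" and f: "continuous (at_right x) f"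
  shows "(\<lambda>n. grid_sample f n x) \<longlonglongrightarrow> f x"
proof -
  define r where "r n = (real (nat \<lfloor>real (Suc n) * x\<rfloor>) + 1) / real (Suc n)" for n
  have r: "x < r n" "r n \<le> x + 1 / real (Suc n)" for n
  proof -
    have "real (nat \<lfloor>real (Suc n) * x\<rfloor>) = of_int \<lfloor>real (Suc n) * x\<rfloor>"
      using x by (simp del: of_nat_Suc add: zero_le_floor)
    then have "real (nat \<lfloor>real (Suc n) * x\<rfloor>) \<le> real (Suc n) * x"
        "real (Suc n) * x < real (nat \<lfloor>real (Suc n) * x\<rfloor>) + 1"
      by linarith+
    then show "x < r n" "r n \<le> x + 1 / real (Suc n)"
      unfolding r_def by (simp_all del: of_nat_Suc add: field_simps)
  qed
  have "filterlim r (at_right x) sequentially"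
  proof (rule filterlim_at_withinI)
    show "r \<longlonglongrightarrow> x"
    proof (rule tendsto_sandwich[of "\<lambda>_. x" r _ "\<lambda>n. x + 1 / real (Suc n)"])
      show "(\<lambda>n. x + 1 / real (Suc n)) \<longlonglongrightarrow> x" by real_asymp
    qed (use r in \<open>auto intro!: always_eventually less_imp_le\<close>)
    show "\<forall>\<^sub>F n in sequentially. r n \<in> {x<..} - {x}"
      using r(1) by (intro always_eventually) (auto simp: less_imp_neq)
  qed
  then have lim: "(\<lambda>n. f (r n)) \<longlonglongrightarrow> f x"
    using f unfolding continuous_within by (rule filterlim_compose[rotated])
  have "\<forall>\<^sub>F n in sequentially. f (r n) = grid_sample f n x"
    using eventually_gt_at_top[of "nat \<lceil>x\<rceil>"]
  proof eventually_elim
    case (elim n)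
    \<comment> \<open>The (n + 1)^2 cells of width 1 / (n + 1) reach up to n + 1, so from here on
      the default value 0 no longer occurs.\<close>
    then have "x < real (Suc n)" by linarith
    then have "real (Suc n) * x < real (Suc n) * real (Suc n)"
      by (intro mult_strict_left_mono) auto
    then have "\<lfloor>real (Suc n) * x\<rfloor> < int ((Suc n)\<^sup>2)"
      unfolding floor_less_iff power2_eq_square by (simp only: of_int_of_nat_eq of_nat_mult of_int_mult)
    moreover have "0 \<le> \<lfloor>real (Suc n) * x\<rfloor>" using x by (simp del: of_nat_Suc)
    ultimately have "nat \<lfloor>real (Suc n) * x\<rfloor> < (Suc n)\<^sup>2" by (simp only: nat_less_iff)
    then show ?case
      unfolding grid_sample_def by (subst sum_grid_cells[OF x]) (simp_all add: r_def)
  qed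
  with lim show ?thesis by (rule Lim_transform_eventually)
qed

lemma borel_measurable_grid_sample:
  fixes X :: "real \<Rightarrow> 'a \<Rightarrow> 'b::{banach, second_countable_topology}"
  assumes [measurable]: "T \<in> borel_measurable M" "\<And>t. 0 \<le> t \<Longrightarrow> X t \<in> borel_measurable M"
  shows "(\<lambda>\<omega>. grid_sample (\<lambda>t. X t \<omega>) n (T \<omega>)) \<in> borel_measurable M"
  unfolding grid_sample_def by measurable

text \<open>Preimages under \<open>f\<close> and \<open>g\<close> differ inside a null set, all of
  whose subsets are measurable by completeness.\<close>

lemma (in complete_measure) borel_measurable_AE_cong:
  assumes [measurable]: "f \<in> borel_measurable M" and ae: "AE x in M. f x = g x"
  shows "g \<in> borel_measurable M"
proof (rule measurableI)
  fix A :: "'b set" assume [measurable]: "A \<in> sets borel"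
  show "g -` A \<inter> space M \<in> sets M"
  proof (rule in_sets_AE)
    show "AE x in M. x \<in> f -` A \<inter> space M \<longleftrightarrow> x \<in> g -` A \<inter> space M"
      using ae by eventually_elim auto
  qed auto
qed simp

text \<open>Measurability at fixed times passes to a random time because each grid sample involves
  only finitely many deterministic times, and the samples converge almost surely.\<close>

lemma (in complete_measure) borel_measurable_time_change:
  fixes X :: "real \<Rightarrow> 'a \<Rightarrow> 'b::{banach, second_countable_topology}"
  assumes T: "T \<in> borel_measurable M" "AE \<omega> in M. 0 \<le> T \<omega>"
    and X: "\<And>t. 0 \<le> t \<Longrightarrow> X t \<in> borel_measurable M"
    and cont: "AE \<omega> in M. \<forall>t\<ge>0. continuous (at_right t) (\<lambda>t. X t \<omega>)"
  shows "(\<lambda>\<omega>. X (T \<omega>) \<omega>) \<in> borel_measurable M"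
proof (rule borel_measurable_AE_cong)
  note [measurable] = borel_measurable_grid_sample[OF T(1) X]
  \<comment> \<open>\<open>lim\<close> of measurable functions is measurable whether or not the
    sequence converges; its value off the convergence set is immaterial.\<close>
  show "(\<lambda>\<omega>. lim (\<lambda>n. grid_sample (\<lambda>t. X t \<omega>) n (T \<omega>))) \<in> borel_measurable M"
    by measurable
  show "AE \<omega> in M. lim (\<lambda>n. grid_sample (\<lambda>t. X t \<omega>) n (T \<omega>)) = X (T \<omega>) \<omega>"
    using T(2) cont by eventually_elim (intro limI grid_sample_LIMSEQ, auto)
qed

text \<open>In a grid sample T enters only through indicators of cells and X only at one fixed time
  per cell, so independence replaces each X(r) by its mean \<phi>(r). Both sides then converge by
  dominated convergence. The indicators are complex-valued because \<open>indep_var\<close> wants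
  equal types.\<close>

lemma (in prob_space) expectation_time_change:
  fixes X :: "real \<Rightarrow> 'a \<Rightarrow> complex" and \<phi> :: "real \<Rightarrow> complex"
  assumes T: "T \<in> borel_measurable M" "AE \<omega> in M. 0 \<le> T \<omega>"
    and X: "\<And>t. 0 \<le> t \<Longrightarrow> X t \<in> borel_measurable M"
    and cont: "AE \<omega> in M. \<forall>t\<ge>0. continuous (at_right t) (\<lambda>t. X t \<omega>)"
    and bound: "\<And>t \<omega>. 0 \<le> t \<Longrightarrow> norm (X t \<omega>) \<le> 1"
    and indep: "\<And>t B. 0 \<le> t \<Longrightarrow> B \<in> sets borel \<Longrightarrow>
          indep_var borel (\<lambda>\<omega>. indicator B (T \<omega>) :: complex) borel (X t)"
    and \<phi>: "\<And>t. 0 \<le> t \<Longrightarrow> (LINT \<omega>|M. X t \<omega>) = \<phi> t"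
    and \<phi>_cont: "continuous_on UNIV \<phi>"
    and XT: "(\<lambda>\<omega>. X (T \<omega>) \<omega>) \<in> borel_measurable M"
  shows "(LINT \<omega>|M. X (T \<omega>) \<omega>) = (LINT \<omega>|M. \<phi> (T \<omega>))"
proof -
  have \<phi>_bound: "norm (\<phi> t) \<le> 1" if "0 \<le> t" for t
  proof -
    have "norm (\<phi> t) \<le> (LINT \<omega>|M. norm (X t \<omega>))"
      using \<phi>[OF that] by (metis integral_norm_bound)
    also have "\<dots> \<le> 1"
      using bound[OF that] X[OF that]
      by (intro integral_le_const integrable_const_bound[where B=1]) auto
    finally show ?thesis .
  qed
  have [measurable]: "\<phi> \<in> borel_measurable borel"
    by (rule borel_measurable_continuous_onI[OF \<phi>_cont])
  have \<phi>_right: "continuous (at_right t) \<phi>" for t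
    using \<phi>_cont continuous_at_imp_continuous_within by (auto simp: continuous_on_eq_continuous_within)
  note [measurable] = T(1) X XT borel_measurable_grid_sample[OF T(1) X]
  have eq: "(LINT \<omega>|M. grid_sample (\<lambda>t. X t \<omega>) n (T \<omega>)) = (LINT \<omega>|M. grid_sample \<phi> n (T \<omega>))" for n
  proof -
    define I where "I k = {real k / real (Suc n)..<(real k + 1) / real (Suc n)}" for k
    define r where "r k = (real k + 1) / real (Suc n)" for k
    have r0: "0 \<le> r k" for k by (simp add: r_def)
    have [measurable]: "I k \<in> sets borel" for k by (simp add: I_def)
    have int1: "integrable M (\<lambda>\<omega>. indicator (I k) (T \<omega>) :: complex)" for k
      by (intro integrable_const_bound[where B=1]) (auto split: split_indicator)
    have int2: "integrable M (X (r k))" for k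
      using bound[OF r0] by (intro integrable_const_bound[where B=1]) (auto intro: X r0)
    have sc: "indicat_real A x *\<^sub>R z = indicator A x * z" for A x and z :: complex
      by (simp split: split_indicator)
    have "(LINT \<omega>|M. grid_sample (\<lambda>t. X t \<omega>) n (T \<omega>))
        = (LINT \<omega>|M. (\<Sum>k<(Suc n)\<^sup>2. indicator (I k) (T \<omega>) * X (r k) \<omega>))"
      unfolding grid_sample_def sc I_def r_def ..
    also have "\<dots> = (\<Sum>k<(Suc n)\<^sup>2. LINT \<omega>|M. indicator (I k) (T \<omega>) * X (r k) \<omega>)"
      by (intro Bochner_Integration.integral_sum indep_var_integrable[OF indep[OF r0] int1 int2]) simp
    also have "\<dots> = (\<Sum>k<(Suc n)\<^sup>2. (LINT \<omega>|M. indicator (I k) (T \<omega>)) * \<phi> (r k))"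
      by (intro sum.cong refl) (simp add: indep_var_lebesgue_integral[OF indep[OF r0] int1 int2] \<phi>[OF r0])
    also have "\<dots> = (LINT \<omega>|M. (\<Sum>k<(Suc n)\<^sup>2. indicator (I k) (T \<omega>) * \<phi> (r k)))"
      by (subst Bochner_Integration.integral_sum) (use int1 in simp_all)
    also have "\<dots> = (LINT \<omega>|M. grid_sample \<phi> n (T \<omega>))"
      unfolding grid_sample_def sc I_def r_def ..
    finally show ?thesis .
  qed
  have "(\<lambda>n. LINT \<omega>|M. grid_sample (\<lambda>t. X t \<omega>) n (T \<omega>)) \<longlonglongrightarrow> (LINT \<omega>|M. X (T \<omega>) \<omega>)"
  proof (rule integral_dominated_convergence[where w="\<lambda>_. 1"])
    show "AE \<omega> in M. (\<lambda>n. grid_sample (\<lambda>t. X t \<omega>) n (T \<omega>)) \<longlonglongrightarrow> X (T \<omega>) \<omega>"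
      using T(2) cont by eventually_elim (intro grid_sample_LIMSEQ, auto)
    show "AE \<omega> in M. norm (grid_sample (\<lambda>t. X t \<omega>) n (T \<omega>)) \<le> 1" for n
      using T(2) by eventually_elim (intro norm_grid_sample_le bound)
  qed auto
  moreover have "(\<lambda>n. LINT \<omega>|M. grid_sample \<phi> n (T \<omega>)) \<longlonglongrightarrow> (LINT \<omega>|M. \<phi> (T \<omega>))"
  proof (rule integral_dominated_convergence[where w="\<lambda>_. 1"])
    show "AE \<omega> in M. (\<lambda>n. grid_sample \<phi> n (T \<omega>)) \<longlonglongrightarrow> \<phi> (T \<omega>)"
      using T(2) by eventually_elim (intro grid_sample_LIMSEQ \<phi>_right)
    show "AE \<omega> in M. norm (grid_sample \<phi> n (T \<omega>)) \<le> 1" for n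
      using T(2) by eventually_elim (intro norm_grid_sample_le \<phi>_bound)
    show "(\<lambda>\<omega>. grid_sample \<phi> n (T \<omega>)) \<in> borel_measurable M" for n
      by (rule borel_measurable_grid_sample) auto
  qed auto
  ultimately show ?thesis
    unfolding eq by (rule LIMSEQ_unique)
qed

text \<open>Adds k = 0, the value belonging to \<xi> = 0: the integrand is then constantly 1 and the
  formula reduces to 1 / \<mu>.\<close>

lemma (in prob_space) laplace_first_passage_nonneg:
  fixes A :: "real \<Rightarrow> 'a \<Rightarrow> real"
  assumes A: "\<And>s. 0 \<le> s \<Longrightarrow> A s \<in> borel_measurable M"
      "AE \<omega> in M. regular_path (\<lambda>s. A s \<omega>)"
      "\<And>s. 0 \<le> s \<Longrightarrow> (LINT \<omega>|M. exp (- \<mu> * A s \<omega>)) = exp (- s * \<Phi>)"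
    and pos: "0 \<le> k" "0 < \<mu>" "0 < \<Phi>"
  defines "L \<equiv> \<lambda>t \<omega>. Inf {s. 0 < s \<and> t \<le> A s \<omega>}"
  defines "\<phi> \<equiv> \<lambda>t. \<integral>\<^sup>+\<omega>. ennreal (exp (- k * L t \<omega>)) \<partial>M"
  shows "\<phi> \<in> borel_measurable borel"
    and "(\<integral>\<^sup>+t. ennreal (exp (- \<mu> * t)) * indicator {0<..} t * \<phi> t \<partial>lborel)
           = ennreal (\<Phi> / (\<mu> * (k + \<Phi>)))"
proof -
  consider "0 < k" | "k = 0" using pos by linarith
  then have "\<phi> \<in> borel_measurable borel \<and>
      (\<integral>\<^sup>+t. ennreal (exp (- \<mu> * t)) * indicator {0<..} t * \<phi> t \<partial>lborel) = ennreal (\<Phi> / (\<mu> * (k + \<Phi>)))"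
  proof cases
    case 1
    then show ?thesis
      using laplace_first_passage[OF A 1 pos(2,3)] unfolding \<phi>_def L_def by auto
  next
    case 2
    then have \<phi>: "\<phi> = (\<lambda>_. 1)" by (simp add: \<phi>_def emeasure_space_1)
    have "(\<integral>\<^sup>+t. ennreal (exp (- \<mu> * t)) * indicator {0<..} t \<partial>lborel)
        = (\<integral>\<^sup>+t. ennreal (exp (- \<mu> * t)) * indicator {0..} t \<partial>lborel)"
    proof (rule nn_integral_cong_AE)
      show "AE t in lborel. ennreal (exp (- \<mu> * t)) * indicator {0<..} t = ennreal (exp (- \<mu> * t)) * indicator {0..} t"
        using AE_lborel_singleton[of 0] by eventually_elim (auto split: split_indicator)
    qed
    also have "\<dots> = ennreal (0 - (- exp (- \<mu> * 0) / \<mu>))"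
    proof (rule nn_integral_FTC_atLeast)
      show "((\<lambda>s. - exp (- \<mu> * s) / \<mu>) \<longlongrightarrow> 0) at_top"
        using pos by real_asymp
    qed (use pos in \<open>auto intro!: derivative_eq_intros\<close>)
    finally show ?thesis using pos 2 by (simp add: \<phi>)
  qed
  then show "\<phi> \<in> borel_measurable borel"
    and "(\<integral>\<^sup>+t. ennreal (exp (- \<mu> * t)) * indicator {0<..} t * \<phi> t \<partial>lborel)
           = ennreal (\<Phi> / (\<mu> * (k + \<Phi>)))" by auto
qed

subsection \<open>The transforms\<close>

text \<open>The exponent 1 / \<nu> of the weights is chosen so that (\<mu>
  \<lambda>^(1/\<nu>))^\<nu> = \<lambda> \<mu>^\<nu>; independence makes the Laplace exponents add
  up.\<close>

lemma (in prob_space) expectation_exp_sum_subordinators: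
  fixes H :: "nat \<Rightarrow> real \<Rightarrow> 'a \<Rightarrow> real"
  assumes H: "\<And>j. j \<in> {1..m} \<Longrightarrow> stable_subordinator M (\<nu> j) (H j)"
    and indep: "indep_vars (\<lambda>_. path_space {0..}) (\<lambda>j. path_on {0..} (H j)) {1..m}"
    and \<nu>: "\<And>j. j \<in> {1..m} \<Longrightarrow> 0 < \<nu> j" and lam: "\<And>j. j \<in> {1..m} \<Longrightarrow> 0 < lam j"
    and s: "0 \<le> s" and \<mu>: "0 < \<mu>"
  shows "(LINT \<omega>|M. exp (- \<mu> * (\<Sum>j=1..m. lam j powr (1 / \<nu> j) * H j s \<omega>)))
           = exp (- s * (\<Sum>j=1..m. lam j * \<mu> powr \<nu> j))"
proof -
  define a where "a j = \<mu> * lam j powr (1 / \<nu> j)" for j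
  have a: "0 < a j" "a j powr \<nu> j = lam j * \<mu> powr \<nu> j" if "j \<in> {1..m}" for j
    using \<mu> \<nu>[OF that] lam[OF that] by (simp_all add: a_def powr_mult powr_powr)
  have lap: "(LINT \<omega>|M. exp (- a j * H j s \<omega>)) = exp (- s * (lam j * \<mu> powr \<nu> j))" if "j \<in> {1..m}" for j
    using H[OF that] a[OF that] s by (simp add: stable_subordinator_def)
  have int: "integrable M (\<lambda>\<omega>. exp (- a j * H j s \<omega>))" if "j \<in> {1..m}" for j
  proof -
    have nonneg: "AE \<omega> in M. \<forall>t\<ge>0. 0 \<le> H j t \<omega>"
      and [measurable]: "H j s \<in> borel_measurable M"
      using H[OF that] s by (auto simp: stable_subordinator_def levy_process_def)
    show ?thesis
    proof (rule integrable_const_bound)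
      show "AE \<omega> in M. norm (exp (- a j * H j s \<omega>)) \<le> 1"
        using nonneg by eventually_elim (use a(1)[OF that] s in auto)
    qed simp
  qed
  \<comment> \<open>Evaluation at s is a measurable map on the path space over {0..}, so
    independence of whole paths descends to the values at time s.\<close>
  have "indep_vars (\<lambda>_. borel) (\<lambda>j \<omega>. exp (- a j * path_on {0..} (H j) \<omega> s)) {1..m}"
    using s by (intro indep_vars_compose2[OF indep]) simp
  then have ind: "indep_vars (\<lambda>_. borel) (\<lambda>j \<omega>. exp (- a j * H j s \<omega>)) {1..m}"
    using s by (simp add: path_on_def)
  have "(LINT \<omega>|M. exp (- \<mu> * (\<Sum>j=1..m. lam j powr (1 / \<nu> j) * H j s \<omega>)))
      = (LINT \<omega>|M. (\<Prod>j=1..m. exp (- a j * H j s \<omega>)))"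
    by (simp add: exp_sum[symmetric] a_def sum_distrib_left sum_negf mult.assoc)
  also have "\<dots> = (\<Prod>j=1..m. LINT \<omega>|M. exp (- a j * H j s \<omega>))"
    by (rule indep_vars_lebesgue_integral[OF _ ind int]) auto
  also have "\<dots> = (\<Prod>j=1..m. exp (- s * (lam j * \<mu> powr \<nu> j)))"
    by (intro prod.cong refl lap)
  also have "\<dots> = exp (- s * (\<Sum>j=1..m. lam j * \<mu> powr \<nu> j))"
    by (simp add: exp_sum[symmetric] sum_distrib_left sum_negf)
  finally show ?thesis .
qed

text \<open>Preimages under the compositions are preimages under X and Y. As
  \<open>indep_var\<close> concerns generated sigma-algebras, the families are first seen to be
  stable under intersection.\<close>

lemma (in prob_space) indep_elements_imp_indep_var:
  assumes ind: "indep_elements M N X K Y"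
    and f: "f \<in> measurable N P" and g: "g \<in> measurable K Q"
  shows "indep_var Q (\<lambda>\<omega>. g (Y \<omega>)) P (\<lambda>\<omega>. f (X \<omega>))"
proof -
  have X: "X \<in> measurable M N" and Y: "Y \<in> measurable M K"
    and sets_indep: "indep_set {X -` A \<inter> space M |A. A \<in> sets N} {Y -` B \<inter> space M |B. B \<in> sets K}"
    using ind by (auto simp: indep_elements_def)
  have fX: "(\<lambda>\<omega>. f (X \<omega>)) \<in> measurable M P" and gY: "(\<lambda>\<omega>. g (Y \<omega>)) \<in> measurable M Q"
    using measurable_compose[OF X f] measurable_compose[OF Y g] .
  have stable: "Int_stable {Z -` A \<inter> space M |A. A \<in> sets R}" for Z :: "'a \<Rightarrow> 'z" and R :: "'z measure"
  proof (rule Int_stableI)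
    fix a b assume "a \<in> {Z -` A \<inter> space M |A. A \<in> sets R}" "b \<in> {Z -` A \<inter> space M |A. A \<in> sets R}"
    then obtain A B where "a = Z -` A \<inter> space M" "A \<in> sets R" "b = Z -` B \<inter> space M" "B \<in> sets R" by blast
    then show "a \<inter> b \<in> {Z -` A \<inter> space M |A. A \<in> sets R}"
      by (intro CollectI exI[of _ "A \<inter> B"]) auto
  qed
  have "indep_set {(\<lambda>\<omega>. g (Y \<omega>)) -` A \<inter> space M |A. A \<in> sets Q}
      {(\<lambda>\<omega>. f (X \<omega>)) -` A \<inter> space M |A. A \<in> sets P}"
  proof (rule indep_setI)
    show "{(\<lambda>\<omega>. g (Y \<omega>)) -` A \<inter> space M |A. A \<in> sets Q} \<subseteq> events"
      using measurable_sets[OF gY] by auto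
    show "{(\<lambda>\<omega>. f (X \<omega>)) -` A \<inter> space M |A. A \<in> sets P} \<subseteq> events"
      using measurable_sets[OF fX] by auto
  next
    fix a b
    assume "a \<in> {(\<lambda>\<omega>. g (Y \<omega>)) -` A \<inter> space M |A. A \<in> sets Q}"
      "b \<in> {(\<lambda>\<omega>. f (X \<omega>)) -` A \<inter> space M |A. A \<in> sets P}"
    then obtain A B where A: "A \<in> sets Q" "a = (\<lambda>\<omega>. g (Y \<omega>)) -` A \<inter> space M"
      and B: "B \<in> sets P" "b = (\<lambda>\<omega>. f (X \<omega>)) -` B \<inter> space M" by blast
    have a: "a = Y -` (g -` A \<inter> space K) \<inter> space M"
      unfolding A(2) using measurable_space[OF Y] by auto
    have b: "b = X -` (f -` B \<inter> space N) \<inter> space M"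
      unfolding B(2) using measurable_space[OF X] by auto
    have "prob (b \<inter> a) = prob b * prob a"
    proof (rule indep_setD[OF sets_indep])
      show "b \<in> {X -` A \<inter> space M |A. A \<in> sets N}"
        unfolding b by (rule CollectI, rule exI, rule conjI[OF refl measurable_sets[OF f B(1)]])
      show "a \<in> {Y -` B \<inter> space M |B. B \<in> sets K}"
        unfolding a by (rule CollectI, rule exI, rule conjI[OF refl measurable_sets[OF g A(1)]])
    qed
    then show "prob (a \<inter> b) = prob a * prob b"
      by (simp add: Int_commute mult.commute)
  qed
  then show ?thesis
    unfolding indep_var_eq using fX gY indep_set_sigma_sets[OF _ stable stable] by blast
qed

theorem theorem2p2:
  fixes M :: "'a measure"
    and m :: nat
    and \<nu> lam :: "nat \<Rightarrow> real"
    and \<beta> c :: real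
    and H :: "nat \<Rightarrow> real \<Rightarrow> 'a \<Rightarrow> real"
    and S :: "real \<Rightarrow> 'a \<Rightarrow> real ^ 'n"
  assumes "prob_space M"
    and "m \<ge> 1"
    and "\<And>j. j \<in> {1..m} \<Longrightarrow> 0 < \<nu> j \<and> \<nu> j \<le> 1"
    and "\<And>j. j \<in> {1..m} \<Longrightarrow> 0 < lam j"
    and "0 < \<beta>" and "\<beta> \<le> 1" and "0 < c"
    and "\<And>j. j \<in> {1..m} \<Longrightarrow> stable_subordinator M (\<nu> j) (H j)"
    and "prob_space.indep_vars M (\<lambda>_. path_space {0..}) (\<lambda>j. path_on {0..} (H j)) {1..m}"
    and "isotropic_stable_process M \<beta> S"
    and "indep_elements (completion M)
           (path_space {0..}) (path_on {0..} S)
           (path_space {0<..}) (path_on {0<..} (inverse_process m \<nu> lam H))"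
  shows "transform_solution m \<nu> lam \<beta> c
           (\<lambda>t. law M (\<lambda>\<omega>. S (c\<^sup>2 * inverse_process m \<nu> lam H t \<omega>) \<omega>))"
proof -
  interpret prob_space M by fact
  \<comment> \<open>First passage times and the time-changed process are handled as random variables
    on the completion, so their expectations are taken there.\<close>
  interpret C: prob_space "completion M" by (rule prob_space_completion)
  define A where "A s \<omega> = (\<Sum>j=1..m. lam j powr (1 / \<nu> j) * H j s \<omega>)" for s \<omega>
  define L where "L = inverse_process m \<nu> lam H"
  define X where "X t \<omega> = S (c\<^sup>2 * L t \<omega>) \<omega>" for t \<omega>
  have L_eq: "L t \<omega> = Inf {s. 0 < s \<and> t \<le> A s \<omega>}" for t \<omega>
    by (simp add: L_def inverse_process_def A_def)
  have A_meas: "A s \<in> borel_measurable M" if "0 \<le> s" for s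
  proof -
    have "H j s \<in> borel_measurable M" if "j \<in> {1..m}" for j
      using assms(8)[OF that] \<open>0 \<le> s\<close> by (simp add: stable_subordinator_def levy_process_def)
    then show ?thesis
      unfolding A_def by (intro borel_measurable_sum borel_measurable_times) auto
  qed
  have reg: "AE \<omega> in M. regular_path (\<lambda>s. A s \<omega>)"
  proof -
    have "AE \<omega> in M. \<forall>j\<in>{1..m}. regular_path (\<lambda>t. H j t \<omega>)"
    proof (rule AE_finite_allI)
      show "AE \<omega> in M. regular_path (\<lambda>t. H j t \<omega>)" if "j \<in> {1..m}" for j
        using AE_regular_path_subordinator[OF assms(8)[OF that]] assms(3)[OF that] by blast
    qed simp
    then show ?thesis
    proof eventually_elim
      case (elim \<omega>)
      then show ?case
        unfolding A_def
      proof (intro regular_path_sum[OF assms(2)])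
        show "0 < lam j powr (1 / \<nu> j)" if "j \<in> {1..m}" for j
          using assms(4)[OF that] by simp
      qed blast
    qed
  qed
  then have regC: "AE \<omega> in completion M. regular_path (\<lambda>s. A s \<omega>)"
    by (rule AE_completion)
  have L0: "AE \<omega> in completion M. 0 \<le> L t \<omega>" for t
    using regC unfolding L_eq by eventually_elim (rule first_passage_nonneg)
  \<comment> \<open>Measurability of \<open>L t\<close> is part of the independence hypothesis,
    whose time set {0<..} omits 0; time 0 is therefore handled separately.\<close>
  have L_meas: "L t \<in> borel_measurable (completion M)" if "0 < t" for t
  proof -
    have "path_on {0<..} L \<in> measurable (completion M) (path_space {0<..})"
      using assms(11) by (simp add: indep_elements_def L_def)
    then have "(\<lambda>\<omega>. path_on {0<..} L \<omega> t) \<in> borel_measurable (completion M)"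
      by (rule measurable_compose) (use that in simp)
    then show ?thesis using that by (simp add: path_on_def)
  qed
  have levyS: "levy_process M S"
    and S_char: "\<And>t \<xi>. 0 \<le> t \<Longrightarrow> (LINT \<omega>|M. iexp (\<xi> \<bullet> S t \<omega>)) = complex_of_real (exp (- t * norm \<xi> powr (2 * \<beta>)))"
    using assms(10) by (auto simp: isotropic_stable_process_def)
  have S_meas: "S t \<in> borel_measurable M" if "0 \<le> t" for t
    using levyS that by (simp add: levy_process_def)
  have S_measC: "S t \<in> borel_measurable (completion M)" if "0 \<le> t" for t
    by (rule measurable_completion[OF S_meas[OF that]])
  have S_cont: "AE \<omega> in completion M. \<forall>t\<ge>0. continuous (at_right t) (\<lambda>t. S t \<omega>)"
    using levyS unfolding levy_process_def cadlag_def by (intro AE_completion) auto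
  have S_zero: "AE \<omega> in completion M. S 0 \<omega> = 0"
    using levyS unfolding levy_process_def by (intro AE_completion) auto
  have X_meas: "X t \<in> borel_measurable (completion M)" if "0 < t" for t
    unfolding X_def
  proof (rule completion.borel_measurable_time_change[OF _ _ S_measC S_cont])
    show "(\<lambda>\<omega>. c\<^sup>2 * L t \<omega>) \<in> borel_measurable (completion M)"
      using L_meas[OF that] by simp
    show "AE \<omega> in completion M. 0 \<le> c\<^sup>2 * L t \<omega>"
      using L0[of t] by eventually_elim simp
  qed
  have X_zero: "AE \<omega> in completion M. X 0 \<omega> = 0"
    using regC S_zero
  proof eventually_elim
    case (elim \<omega>)
    \<comment> \<open>Level 0 is reached at every positive time, so the passage time is 0.\<close>
    have "L 0 \<omega> \<le> 0"
      unfolding L_eq first_passage_le_iff[OF elim(1) order_refl]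
      using regular_path_nonneg[OF elim(1)] by simp
    then have "L 0 \<omega> = 0"
      using first_passage_nonneg[OF elim(1), of 0] by (simp add: L_eq)
    then show ?case using elim(2) by (simp add: X_def)
  qed
  have X_meas_zero: "X 0 \<in> borel_measurable (completion M)"
    by (rule completion.borel_measurable_AE_cong[of "\<lambda>_. 0"]) (use X_zero in auto)
  have fourier_law: "fourier (law M (X t)) \<xi> = (LINT \<omega>|completion M. iexp (\<xi> \<bullet> X t \<omega>))" if "0 \<le> t" for t \<xi>
    unfolding fourier_def law_def
  proof (rule integral_distr)
    show "X t \<in> borel_measurable (completion M)"
      using X_meas[of t] X_meas_zero that by (cases "t = 0") auto
  qed measurable
  have fourier_zero: "fourier (law M (X 0)) \<xi> = 1" for \<xi>
  proof -
    have "(LINT \<omega>|completion M. iexp (\<xi> \<bullet> X 0 \<omega>)) = (LINT \<omega>|completion M. 1)"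
    proof (rule integral_cong_AE)
      show "AE \<omega> in completion M. iexp (\<xi> \<bullet> X 0 \<omega>) = 1"
        using X_zero by eventually_elim simp
    qed (use X_meas_zero in measurable)
    then show ?thesis by (simp add: fourier_law prob_space)
  qed
  have fourier_pos: "fourier (law M (X t)) \<xi>
      = complex_of_real (LINT \<omega>|completion M. exp (- (c\<^sup>2 * norm \<xi> powr (2 * \<beta>)) * L t \<omega>))"
    if "0 < t" for t \<xi>
  proof -
    define \<phi> where "\<phi> s = complex_of_real (exp (- s * norm \<xi> powr (2 * \<beta>)))" for s
    have "(LINT \<omega>|completion M. iexp (\<xi> \<bullet> S (c\<^sup>2 * L t \<omega>) \<omega>)) = (LINT \<omega>|completion M. \<phi> (c\<^sup>2 * L t \<omega>))"
    proof (rule C.expectation_time_change)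
      show "(\<lambda>\<omega>. c\<^sup>2 * L t \<omega>) \<in> borel_measurable (completion M)"
        using L_meas[OF that] by simp
      show "AE \<omega> in completion M. 0 \<le> c\<^sup>2 * L t \<omega>"
        using L0[of t] by eventually_elim simp
      show "(\<lambda>\<omega>. iexp (\<xi> \<bullet> S u \<omega>)) \<in> borel_measurable (completion M)" if "0 \<le> u" for u
        using S_measC[OF that] by measurable
      show "AE \<omega> in completion M. \<forall>u\<ge>0. continuous (at_right u) (\<lambda>u. iexp (\<xi> \<bullet> S u \<omega>))"
        using S_cont by eventually_elim (intro allI impI continuous_intros, auto)
      show "norm (iexp (\<xi> \<bullet> S u \<omega>)) \<le> 1" for u \<omega> by simp
      show "C.indep_var borel (\<lambda>\<omega>. indicator B (c\<^sup>2 * L t \<omega>) :: complex) borel (\<lambda>\<omega>. iexp (\<xi> \<bullet> S u \<omega>))"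
        if u: "0 \<le> u" and [measurable]: "B \<in> sets borel" for u B
      proof -
        \<comment> \<open>Evaluating the path of L at t and that of S at u is measurable, so
          independence of the paths gives independence of these two variables.\<close>
        have "C.indep_var borel (\<lambda>\<omega>. indicator B (c\<^sup>2 * path_on {0<..} L \<omega> t) :: complex)
            borel (\<lambda>\<omega>. iexp (\<xi> \<bullet> path_on {0..} S \<omega> u))"
        proof (rule C.indep_elements_imp_indep_var[where f = "\<lambda>p. iexp (\<xi> \<bullet> p u)"
              and g = "\<lambda>p. indicator B (c\<^sup>2 * p t)"])
          have [measurable]: "(\<lambda>p. p u) \<in> measurable (path_space {0..}) (borel :: (real ^ 'n) measure)"
            using u by simp
          have [measurable]: "(\<lambda>p. p t) \<in> measurable (path_space {0<..}) (borel :: real measure)"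
            using \<open>0 < t\<close> by simp
          show "(\<lambda>p. iexp (\<xi> \<bullet> p u)) \<in> borel_measurable (path_space {0..} :: (real \<Rightarrow> real ^ 'n) measure)"
            by measurable
          show "(\<lambda>p. indicator B (c\<^sup>2 * p t) :: complex) \<in> borel_measurable (path_space {0<..} :: (real \<Rightarrow> real) measure)"
            by measurable
        qed (use assms(11) in \<open>simp add: L_def\<close>)
        then show ?thesis using u \<open>0 < t\<close> by (simp add: path_on_def)
      qed
      show "(LINT \<omega>|completion M. iexp (\<xi> \<bullet> S u \<omega>)) = \<phi> u" if "0 \<le> u" for u
      proof -
        have "(\<lambda>\<omega>. iexp (\<xi> \<bullet> S u \<omega>)) \<in> borel_measurable M"
          using S_meas[OF that] by measurable
        then show ?thesis
          using S_char[OF that] by (simp add: integral_completion \<phi>_def)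
      qed
      show "continuous_on UNIV \<phi>"
        unfolding \<phi>_def by (intro continuous_intros)
      show "(\<lambda>\<omega>. iexp (\<xi> \<bullet> S (c\<^sup>2 * L t \<omega>) \<omega>)) \<in> borel_measurable (completion M)"
        using X_meas[OF that] unfolding X_def by measurable
    qed
    also have "(LINT \<omega>|completion M. \<phi> (c\<^sup>2 * L t \<omega>))
        = (LINT \<omega>|completion M. complex_of_real (exp (- (c\<^sup>2 * norm \<xi> powr (2 * \<beta>)) * L t \<omega>)))"
      by (simp add: \<phi>_def mult_ac)
    also have "\<dots> = complex_of_real (LINT \<omega>|completion M. exp (- (c\<^sup>2 * norm \<xi> powr (2 * \<beta>)) * L t \<omega>))"
      by (rule integral_complex_of_real)
    finally show ?thesis
      using fourier_law[of t] that by (simp add: X_def)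
  qed
  have cont: "continuous (at_right 0) (\<lambda>t. fourier (law M (X t)) \<xi>)" for \<xi>
  proof -
    define k where "k = c\<^sup>2 * norm \<xi> powr (2 * \<beta>)"
    have k: "0 \<le> k" by (simp add: k_def)
    have "((\<lambda>t. fourier (law M (X t)) \<xi>) \<longlongrightarrow> 1) (at_right 0)"
    \<comment> \<open>Sequences decreasing to 0 make dominated convergence applicable.\<close>
    proof (rule tendsto_at_right_sequentially[of 0 1])
      fix r :: "nat \<Rightarrow> real" assume r: "\<And>n. 0 < r n" "r \<longlonglongrightarrow> 0"
      have "(\<lambda>n. LINT \<omega>|completion M. exp (- k * L (r n) \<omega>)) \<longlonglongrightarrow> (LINT \<omega>|completion M. 1)"
      proof (rule integral_dominated_convergence[where w="\<lambda>_. 1"])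
        show "AE \<omega> in completion M. (\<lambda>n. exp (- k * L (r n) \<omega>)) \<longlonglongrightarrow> 1"
          using regC
        proof eventually_elim
          case (elim \<omega>)
          have "(\<lambda>n. L (r n) \<omega>) \<longlonglongrightarrow> 0"
          proof (rule LIMSEQ_I)
            fix e :: real assume "0 < e"
            \<comment> \<open>Strict positivity of the path is decisive: once r(n) is below A(e /
              2), the passage time is at most e / 2 and so less than e.\<close>
            then have "0 < A (e / 2) \<omega>" using elim by (simp add: regular_path_def)
            then have "\<forall>\<^sub>F n in sequentially. r n < A (e / 2) \<omega>"
              using order_tendstoD(2)[OF r(2)] by simp
            then obtain N where N: "\<And>n. N \<le> n \<Longrightarrow> r n < A (e / 2) \<omega>"
              by (auto simp: eventually_sequentially)
            have "norm (L (r n) \<omega> - 0) < e" if "N \<le> n" for n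
            proof -
              have "L (r n) \<omega> \<le> e / 2"
                unfolding L_eq using first_passage_le_iff[OF elim, of "e / 2" "r n"] N[OF that] \<open>0 < e\<close> by simp
              moreover have "0 \<le> L (r n) \<omega>"
                unfolding L_eq by (rule first_passage_nonneg[OF elim])
              ultimately show ?thesis using \<open>0 < e\<close> by simp
            qed
            then show "\<exists>N. \<forall>n\<ge>N. norm (L (r n) \<omega> - 0) < e" by blast
          qed
          then have "(\<lambda>n. exp (- k * L (r n) \<omega>)) \<longlonglongrightarrow> exp (- k * 0)"
            by (intro tendsto_intros)
          then show ?case by simp
        qed
        show "AE \<omega> in completion M. norm (exp (- k * L (r n) \<omega>)) \<le> 1" for n
          using L0[of "r n"] by eventually_elim (use k in simp)
        show "(\<lambda>\<omega>. exp (- k * L (r n) \<omega>)) \<in> borel_measurable (completion M)" for n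
          using L_meas[OF r(1)] by measurable
      qed auto
      then have "(\<lambda>n. complex_of_real (LINT \<omega>|completion M. exp (- k * L (r n) \<omega>))) \<longlonglongrightarrow> complex_of_real 1"
        by (intro tendsto_of_real) (simp add: prob_space)
      then show "(\<lambda>n. fourier (law M (X (r n))) \<xi>) \<longlonglongrightarrow> 1"
        using fourier_pos[OF r(1)] by (simp add: k_def)
    qed simp
    then show ?thesis by (simp add: continuous_within fourier_zero)
  qed
  have eq: "laplace_exists (\<lambda>t. fourier (law M (X t)) \<xi>) \<mu> \<and>
      (let W = laplace (\<lambda>t. fourier (law M (X t)) \<xi>) \<mu> in
        (\<Sum>j=1..m. of_real (lam j) * (of_real (\<mu> powr \<nu> j) * W - of_real (\<mu> powr (\<nu> j - 1))))
          = - of_real (c\<^sup>2 * norm \<xi> powr (2 * \<beta>)) * W)" if \<mu>: "0 < \<mu>" for \<xi> \<mu>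
  proof -
    define k where "k = c\<^sup>2 * norm \<xi> powr (2 * \<beta>)"
    have k: "0 \<le> k" by (simp add: k_def)
    define \<Phi> where "\<Phi> = (\<Sum>j=1..m. lam j * \<mu> powr \<nu> j)"
    have \<Phi>: "0 < \<Phi>"
      unfolding \<Phi>_def
    proof (rule sum_pos)
      show "0 < lam j * \<mu> powr \<nu> j" if "j \<in> {1..m}" for j
        using assms(4)[OF that] \<mu> by simp
    qed (use assms(2) in simp_all)
    define \<phi> where "\<phi> t = (\<integral>\<^sup>+\<omega>. ennreal (exp (- k * L t \<omega>)) \<partial>M)" for t
    define w where "w = \<Phi> / (\<mu> * (k + \<Phi>))"
    have lap: "(LINT \<omega>|M. exp (- \<mu> * A s \<omega>)) = exp (- s * \<Phi>)" if "0 \<le> s" for s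
      unfolding A_def \<Phi>_def
      by (rule expectation_exp_sum_subordinators[OF assms(8,9) conjunct1[OF assms(3)] assms(4) that \<mu>])
    have [measurable]: "\<phi> \<in> borel_measurable borel"
      and \<phi>_lap: "(\<integral>\<^sup>+t. ennreal (exp (- \<mu> * t)) * indicator {0<..} t * \<phi> t \<partial>lborel) = ennreal w"
      using laplace_first_passage_nonneg[OF A_meas reg lap k \<mu> \<Phi>]
      unfolding \<phi>_def[symmetric] L_eq[symmetric] w_def[symmetric] by blast+
    \<comment> \<open>\<open>\<phi>\<close> integrates over \<open>M\<close>, while its integrand is
      known to be measurable only for the completion; nonnegative integrals over the two measures
      coincide.\<close>
    have \<phi>_eq: "\<phi> t = ennreal (LINT \<omega>|completion M. exp (- k * L t \<omega>))" if "0 < t" for t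
    proof -
      have bound: "AE \<omega> in completion M. norm (exp (- k * L t \<omega>)) \<le> 1"
        using L0[of t] by eventually_elim (use k in simp)
      have "integrable (completion M) (\<lambda>\<omega>. exp (- k * L t \<omega>))"
        using L_meas[OF that] by (intro C.integrable_const_bound[OF bound]) measurable
      then show ?thesis
        unfolding \<phi>_def nn_integral_completion[symmetric, of M]
        by (intro nn_integral_eq_integral) auto
    qed
    \<comment> \<open>Measurability in t of the Fourier transform is obtained through
      \<open>\<phi>\<close>. Its real-valued version \<open>G\<close> agrees with the transform for
      t > 0, the range of the Laplace integral.\<close>
    define G where "G t = enn2real (\<phi> t)" for t
    have G: "fourier (law M (X t)) \<xi> = complex_of_real (G t)" "\<phi> t = ennreal (G t)" if "0 < t" for t
      using fourier_pos[OF that, of \<xi>] \<phi>_eq[OF that] by (simp_all add: G_def k_def)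
    have G_nonneg: "0 \<le> G t" for t by (simp add: G_def)
    have w: "0 \<le> w" using \<mu> k \<Phi> by (simp add: w_def)
    have "has_bochner_integral lborel (\<lambda>t. indicator {0<..} t * (exp (- \<mu> * t) * G t)) w"
    proof (rule has_bochner_integral_nn_integral)
      show "(\<lambda>t. indicator {0<..} t * (exp (- \<mu> * t) * G t)) \<in> borel_measurable lborel"
        unfolding G_def by measurable
      show "AE t in lborel. 0 \<le> indicator {0<..} t * (exp (- \<mu> * t) * G t)"
        by (simp add: G_def)
      have "(\<integral>\<^sup>+t. ennreal (indicator {0<..} t * (exp (- \<mu> * t) * G t)) \<partial>lborel)
          = (\<integral>\<^sup>+t. ennreal (exp (- \<mu> * t)) * indicator {0<..} t * \<phi> t \<partial>lborel)"
        by (intro nn_integral_cong)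
          (auto simp: G(2) ennreal_mult G_nonneg split: split_indicator)
      then show "(\<integral>\<^sup>+t. ennreal (indicator {0<..} t * (exp (- \<mu> * t) * G t)) \<partial>lborel) = ennreal w"
        using \<phi>_lap by simp
    qed (rule w)
    then have "has_bochner_integral lborel
        (\<lambda>t. complex_of_real (indicator {0<..} t * (exp (- \<mu> * t) * G t))) (complex_of_real w)"
      by (rule has_bochner_integral_of_real)
    moreover have "complex_of_real (indicator {0<..} t * (exp (- \<mu> * t) * G t))
        = indicat_real {0<..} t *\<^sub>R (exp (- \<mu> * t) *\<^sub>R fourier (law M (X t)) \<xi>)" for t
      by (auto simp: G(1) scaleR_conv_of_real split: split_indicator)
    ultimately have hbi: "has_bochner_integral lborel
        (\<lambda>t. indicat_real {0<..} t *\<^sub>R (exp (- \<mu> * t) *\<^sub>R fourier (law M (X t)) \<xi>)) (complex_of_real w)"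
      by simp
    have ex: "laplace_exists (\<lambda>t. fourier (law M (X t)) \<xi>) \<mu>"
      using hbi by (simp add: laplace_exists_def set_integrable_def has_bochner_integral_iff)
    have W: "laplace (\<lambda>t. fourier (law M (X t)) \<xi>) \<mu> = complex_of_real w"
      using hbi by (simp add: laplace_def set_lebesgue_integral_def has_bochner_integral_iff)
    \<comment> \<open>As \<mu>^(\<nu> - 1) = \<mu>^\<nu> / \<mu>, every summand contains the factor
      w - 1 / \<mu>, which equals - k / (\<mu> (k + \<Phi>)).\<close>
    have "(\<Sum>j=1..m. lam j * (\<mu> powr \<nu> j * w - \<mu> powr (\<nu> j - 1)))
        = (\<Sum>j=1..m. lam j * \<mu> powr \<nu> j * (w - 1 / \<mu>))"
      using \<mu> by (intro sum.cong refl) (simp add: powr_diff field_simps)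
    also have "\<dots> = \<Phi> * (w - 1 / \<mu>)"
      by (simp add: \<Phi>_def sum_distrib_right)
    also have "\<dots> = - k * w"
    proof -
      define d where "d = k + \<Phi>"
      have "d \<noteq> 0" using k \<Phi> by (simp add: d_def)
      then have "w - 1 / \<mu> = (\<Phi> - d) / (\<mu> * d)"
        by (simp add: w_def d_def[symmetric] diff_divide_distrib)
      then show ?thesis by (simp add: w_def d_def)
    qed
    finally have "complex_of_real (\<Sum>j=1..m. lam j * (\<mu> powr \<nu> j * w - \<mu> powr (\<nu> j - 1))) = complex_of_real (- k * w)"
      by simp
    then show ?thesis
      unfolding W k_def[symmetric] using ex by simp
  qed
  show ?thesis
    unfolding transform_solution_def X_def[symmetric] L_def[symmetric]
    using fourier_zero cont eq by blast
qed

end
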